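(* Let $0<\lambda\le1$, $f\in\mathcal{U}(\lambda)$ and $k_\lambda(z)=\dfrac{z}{(1-z)(1-\lambda z)}$. Then for any $0<r<1$ and any $p\in\mathbb{R}$, $$\frac{1}{2\pi}\int_0^{2\pi}|f(re^{i\theta})|^p\,d\theta\le\frac{1}{2\pi}\int_0^{2\pi}|k_\lambda(re^{i\theta})|^p\,d\theta.$$
   Context: $\mathbb{D}=\{z\in\mathbb{C}:|z|<1\}$. $\mathcal{A}$ is the set of analytic functions on $\mathbb{D}$ of the form $f(z)=z+\sum_{n=2}^\infty a_nz^n$. For $0<\lambda\le1$, $\mathcal{U}(\lambda)$ is the class of $f\in\mathcal{A}$ satisfying $\left|f'(z)\left(\frac{z}{f(z)}\right)^2-1\right|<\lambda$ for all $z\in\mathbb{D}$ (where $z/f(z)$ has the value $1$ at $z=0$; such $f$ is nonvanishing in $\mathbb{D}\setminus\{0\}$). *)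

theory Defs
  imports "HOL-Analysis.Analysis"
begin

definition unit_disc :: "complex set" where
  "unit_disc = {z. cmod z < 1}"

definition class_A :: "(complex \<Rightarrow> complex) set" where
  "class_A = {f. f holomorphic_on unit_disc \<and>
     (\<exists>a :: nat \<Rightarrow> complex. a 0 = 0 \<and> a 1 = 1 \<and>
        (\<forall>z\<in>unit_disc. (\<lambda>n. a n * z ^ n) sums f z))}"

(* The first conjunct makes z / f z meaningful away from the origin; at the origin
   the removable singularity is filled with the value 1. *)
definition class_U :: "real \<Rightarrow> (complex \<Rightarrow> complex) set" where
  "class_U lam = {f \<in> class_A.
     (\<forall>z\<in>unit_disc - {0}. f z \<noteq> 0) \<and>
     (\<forall>z\<in>unit_disc.
        cmod (deriv f z * (if z = 0 then 1 else z / f z) ^ 2 - 1) < lam)}"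

definition k_fun :: "real \<Rightarrow> complex \<Rightarrow> complex" where
  "k_fun lam z = z / ((1 - z) * (1 - of_real lam * z))"

end

theory Submission
  imports Defs "HOL-Complex_Analysis.Complex_Analysis"
begin

text \<open>
  Put \<open>g = z / f\<close> and write \<open>g z = 1 + z * m z\<close>. Then \<open>f' (z / f)\<^sup>2 - 1 = - z\<^sup>2 m'\<close>, so membership in
  the class says that \<open>g\<close> has no zeros and, by the maximum principle, that \<open>\<bar>m'\<bar> \<le> \<lambda>\<close>
  (\<open>class_U_reciprocal\<close>). With \<open>q = - p\<close> the claim is that the mean of \<open>\<bar>g\<bar>\<close> to the power \<open>q\<close> on
  \<open>\<bar>z\<bar> = r\<close> is largest for \<open>(1 - z) (1 - \<lambda> z)\<close>. Littlewood's subordination theorem alone does not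
  give this: for \<open>\<lambda> < 1\<close> the function \<open>(1 - z) (1 - \<i> \<lambda> z)\<close> is an admissible \<open>g\<close> that is not
  subordinate to \<open>(1 - z) (1 - \<lambda> z)\<close>. Two other ideas carry the proof.

  First, embed \<open>g\<close> in the affine family \<open>g\<^sub>b z = 1 + z (m z + b)\<close>. The parameters \<open>b\<close> for which
  \<open>g\<^sub>b\<close> has no zero in \<open>\<bar>z\<bar> < s\<close>, where \<open>r < s < 1\<close>, form a compact set containing \<open>0\<close>. Powers of
  nonvanishing functions are locally moduli of holomorphic functions of \<open>b\<close>, so the mean obeys a maximum
  principle in \<open>b\<close> (\<open>integral_norm_powr_affine_le_frontier\<close>) and it is enough to bound it for
  frontier parameters. For those \<open>g\<^sub>b\<close> has a zero \<open>x\<close> with \<open>\<bar>x\<bar> = s\<close>, and it splits as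
  \<open>g\<^sub>b z = (1 - z / x) (1 - \<lambda> \<omega> z)\<close>. The bound on \<open>m'\<close> makes \<open>\<omega>\<close> a Schwarz function, because \<open>\<omega>\<close> is
  a difference quotient of \<open>m\<close> multiplied by \<open>z x / \<lambda>\<close> (\<open>frontier_mean_le\<close>).

  Secondly, among all Schwarz functions \<open>\<omega>\<close> the mean of \<open>\<bar>(1 - \<rho> z) (1 - l \<omega> z)\<bar>\<close> to the power \<open>q\<close> on the
  unit circle is largest for \<open>\<omega> z = z\<close> (\<open>two_factor_mean_le\<close>). There the factors \<open>\<bar>1 - \<rho> z\<bar>\<close> and \<open>\<bar>1 - l z\<bar>\<close>
  to the power \<open>q\<close> are functions \<open>U\<close> and \<open>V\<close> of \<open>c = Re z\<close>, monotone in the same direction. As in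
  optimal transport, this gives \<open>U c * V d \<le> \<alpha> c + \<beta> d\<close> with equality for \<open>c = d\<close>
  (\<open>comonotone_product_split\<close>). If \<open>B\<close> is harmonic with boundary values \<open>\<beta> (Re z)\<close>, the
  maximum principle extends the inequality from \<open>\<bar>w\<bar> = 1\<close> to \<open>\<bar>w\<bar> \<le> 1\<close>, with \<open>B w\<close> in place of
  \<open>\<beta> d\<close>. Put \<open>w = \<omega> z\<close> and integrate over the circle: by the mean value property \<open>B \<circ> \<omega>\<close> and \<open>B\<close>
  have the same mean \<open>B 0\<close>, so \<open>\<omega>\<close> drops out (\<open>integral_subordinate_le\<close>).

  The resulting bound is the mean for \<open>(1 - z / s) (1 - \<lambda> z)\<close> on \<open>\<bar>z\<bar> = r\<close>, and \<open>s \<rightarrow> 1\<close> gives the claim.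
\<close>

section \<open>Comonotone products and composition with a Schwarz function\<close>

text \<open>
  This is the dual potential of the transport problem with cost \<open>- U c * V d\<close>, for which the
  diagonal is optimal. Take for \<open>\<beta>\<close> an antiderivative of \<open>U * V'\<close>; then the inequality says that
  the integral of \<open>(U t - U c) * V' t\<close> from \<open>c\<close> to \<open>d\<close> is nonnegative.
\<close>
lemma comonotone_product_split:
  fixes U V V' :: "real \<Rightarrow> real"
  assumes contU: "continuous_on {a..b} U" and contV': "continuous_on {a..b} V'"
    and derV: "\<And>x. x \<in> {a..b} \<Longrightarrow> (V has_real_derivative V' x) (at x within {a..b})"
    and same: "\<And>x y. x \<in> {a..b} \<Longrightarrow> y \<in> {a..b} \<Longrightarrow> 0 \<le> (U x - U y) * V' x * (x - y)"
  obtains \<alpha> \<beta> :: "real \<Rightarrow> real"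
  where "continuous_on {a..b} \<alpha>" "continuous_on {a..b} \<beta>"
    "\<And>c d. c \<in> {a..b} \<Longrightarrow> d \<in> {a..b} \<Longrightarrow> U c * V d \<le> \<alpha> c + \<beta> d"
    "\<And>c. U c * V c = \<alpha> c + \<beta> c"
proof -
  have "continuous_on {a..b} (\<lambda>x. U x * V' x)"
    by (intro continuous_intros contU contV')
  then obtain \<beta> where \<beta>:
    "\<And>x. x \<in> {a..b} \<Longrightarrow> (\<beta> has_vector_derivative (U x * V' x)) (at x within {a..b})"
    using antiderivative_continuous by metis
  define \<alpha> where "\<alpha> = (\<lambda>c. U c * V c - \<beta> c)"
  have contV: "continuous_on {a..b} V"
    by (rule DERIV_continuous_on[OF derV])
  have cont\<beta>: "continuous_on {a..b} \<beta>"
    by (rule continuous_on_vector_derivative[OF \<beta>])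
  have main: "U c * (V d - V c) \<le> \<beta> d - \<beta> c" if c: "c \<in> {a..b}" and d: "d \<in> {a..b}" for c d
  proof -
    have der: "((\<lambda>t. \<beta> t - U c * V t) has_vector_derivative ((U t - U c) * V' t)) (at t within T)"
      if "t \<in> T" "T \<subseteq> {a..b}" for t T
    proof -
      have "((\<lambda>t. \<beta> t - U c * V t) has_vector_derivative (U t * V' t - U c * V' t)) (at t within {a..b})"
        using \<beta>[of t] derV[of t] that
        by (auto intro!: derivative_eq_intros simp: has_real_derivative_iff_has_vector_derivative)
      then have "((\<lambda>t. \<beta> t - U c * V t) has_vector_derivative ((U t - U c) * V' t)) (at t within {a..b})"
        by (simp add: algebra_simps)
      then show ?thesis
        by (rule has_vector_derivative_within_subset) fact
    qed
    have int: "((\<lambda>t. (U t - U c) * V' t) has_integral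
        ((\<beta> v - U c * V v) - (\<beta> u - U c * V u))) {u..v}"
      if "u \<le> v" "u \<in> {a..b}" "v \<in> {a..b}" for u v
      by (rule fundamental_theorem_of_calculus[OF that(1)]) (use that in \<open>auto intro!: der\<close>)
    show ?thesis
    proof (cases "c \<le> d")
      case True
      have "0 \<le> (\<beta> d - U c * V d) - (\<beta> c - U c * V c)"
      proof (rule has_integral_nonneg[OF int[OF True c d]])
        fix t assume t: "t \<in> {c..d}"
        then have "0 \<le> (U t - U c) * V' t * (t - c)" using same[of t c] c d by auto
        with t show "0 \<le> (U t - U c) * V' t"
          by (cases "t = c") (auto simp: zero_le_mult_iff)
      qed
      then show ?thesis by (simp add: algebra_simps)
    next
      case False
      then have "d \<le> c" by simp
      have "0 \<le> - ((\<beta> c - U c * V c) - (\<beta> d - U c * V d))"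
      proof (rule has_integral_nonneg[OF has_integral_neg[OF int[OF \<open>d \<le> c\<close> d c]]])
        fix t assume t: "t \<in> {d..c}"
        then have "0 \<le> (U t - U c) * V' t * (t - c)" using same[of t c] c d by auto
        with t show "0 \<le> - ((U t - U c) * V' t)"
          by (cases "t = c") (auto simp: zero_le_mult_iff)
      qed
      then show ?thesis by (simp add: algebra_simps)
    qed
  qed
  show thesis
  proof
    show "continuous_on {a..b} \<alpha>" unfolding \<alpha>_def by (intro continuous_intros contU contV cont\<beta>)
    show "continuous_on {a..b} \<beta>" by fact
    show "U c * V d \<le> \<alpha> c + \<beta> d" if "c \<in> {a..b}" "d \<in> {a..b}" for c d
      using main[OF that] by (simp add: \<alpha>_def algebra_simps)
  qed (simp add: \<alpha>_def)
qed

text \<open>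
  Expand \<open>(z + cnj z) ^ n\<close>. On the unit circle \<open>z ^ k * cnj z ^ (n - k)\<close> is a power of \<open>z\<close> or of
  \<open>cnj z\<close>, and both have the same real part.
\<close>
lemma Re_power_eq_harmonic_on_circle:
  obtains Q where "Q holomorphic_on UNIV" "\<And>z. cmod z = 1 \<Longrightarrow> Re (Q z) = Re z ^ n"
proof
  define e where "e = (\<lambda>k. if n \<le> 2 * k then 2 * k - n else n - 2 * k)"
  define Q where "Q = (\<lambda>z::complex. (\<Sum>k\<le>n. of_nat (n choose k) * z ^ e k) / 2 ^ n)"
  show "Q holomorphic_on UNIV"
    unfolding Q_def by (intro holomorphic_intros) auto
  fix z :: complex assume z: "cmod z = 1"
  then have zz: "z * cnj z = 1" by (simp add: complex_norm_square[symmetric])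
  have summand: "Re (z ^ k * cnj z ^ (n - k)) = Re (z ^ e k)" if "k \<le> n" for k
  proof (cases "n \<le> 2 * k")
    case True
    then have "z ^ k = z ^ (2 * k - n) * z ^ (n - k)"
      using that by (simp flip: power_add)
    then have "z ^ k * cnj z ^ (n - k) = z ^ (2 * k - n) * (z * cnj z) ^ (n - k)"
      by (simp add: power_mult_distrib)
    with True zz show ?thesis by (simp add: e_def)
  next
    case False
    then have "cnj z ^ (n - k) = cnj z ^ (n - 2 * k) * cnj z ^ k"
      by (simp flip: power_add)
    then have "z ^ k * cnj z ^ (n - k) = cnj (z ^ (n - 2 * k)) * (z * cnj z) ^ k"
      by (simp add: power_mult_distrib)
    then have "z ^ k * cnj z ^ (n - k) = cnj (z ^ (n - 2 * k))"
      by (simp only: zz power_one mult_1_right)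
    with False show ?thesis by (simp only: complex_cnj cnj.sel e_def if_False)
  qed
  have "complex_of_real ((2 * Re z) ^ n) = (z + cnj z) ^ n"
    by (simp add: complex_add_cnj)
  also have "\<dots> = (\<Sum>k\<le>n. of_nat (n choose k) * z ^ k * cnj z ^ (n - k))"
    by (rule binomial_ring)
  finally have "(2 * Re z) ^ n = Re (\<Sum>k\<le>n. of_nat (n choose k) * z ^ k * cnj z ^ (n - k))"
    by (metis Re_complex_of_real)
  also have "\<dots> = (\<Sum>k\<le>n. (n choose k) * Re (z ^ k * cnj z ^ (n - k)))"
    by (simp add: mult.assoc Re_sum)
  also have "\<dots> = (\<Sum>k\<le>n. (n choose k) * Re (z ^ e k))"
    by (rule sum.cong[OF refl]) (simp only: atMost_iff summand)
  finally have "2 ^ n * Re z ^ n = (\<Sum>k\<le>n. (n choose k) * Re (z ^ e k))"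
    by (simp add: power_mult_distrib)
  moreover have "Re (Q z) = (\<Sum>k\<le>n. (n choose k) * Re (z ^ e k)) / 2 ^ n"
  proof -
    have "Q z = (\<Sum>k\<le>n. of_nat (n choose k) * z ^ e k) / of_real (2 ^ n)"
      by (simp add: Q_def)
    then show ?thesis by (simp only: Re_divide_of_real) (simp add: Re_sum)
  qed
  ultimately show "Re (Q z) = Re z ^ n"
    by (metis nonzero_mult_div_cancel_left power_not_zero zero_neq_numeral)
qed

text \<open>
  An approximate solution of the Dirichlet problem for boundary values that depend only on \<open>Re z\<close>:
  approximate \<open>\<beta>\<close> by a polynomial and replace each power of \<open>Re z\<close> by a harmonic polynomial.
\<close>
lemma approx_by_harmonic_on_circle:
  fixes \<beta> :: "real \<Rightarrow> real"
  assumes "continuous_on {-1..1} \<beta>" "0 < \<epsilon>"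
  obtains Q where "Q holomorphic_on UNIV"
    "\<And>z. cmod z = 1 \<Longrightarrow> \<bar>\<beta> (Re z) - Re (Q z)\<bar> < \<epsilon>"
proof -
  obtain g where g: "real_polynomial_function g" "\<And>x. x \<in> {-1..1} \<Longrightarrow> \<bar>\<beta> x - g x\<bar> < \<epsilon>"
    using Stone_Weierstrass_real_polynomial_function[OF compact_Icc assms] by blast
  then obtain a n where a: "g = (\<lambda>x. \<Sum>i\<le>n. a i * x ^ i)"
    using real_polynomial_function_iff_sum by blast
  have "\<exists>Q. Q holomorphic_on UNIV \<and> (\<forall>z. cmod z = 1 \<longrightarrow> Re (Q z) = Re z ^ i)" for i
    by (rule Re_power_eq_harmonic_on_circle[of i]) blast
  then obtain P where P: "\<And>i. P i holomorphic_on UNIV"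
    "\<And>i z. cmod z = 1 \<Longrightarrow> Re (P i z) = Re z ^ i"
    by metis
  show thesis
  proof
    show "(\<lambda>z. \<Sum>i\<le>n. of_real (a i) * P i z) holomorphic_on UNIV"
      by (intro holomorphic_intros P)
    fix z :: complex assume z: "cmod z = 1"
    then have "Re z \<in> {-1..1}" using abs_Re_le_cmod[of z] by auto
    with g(2)[of "Re z"] show "\<bar>\<beta> (Re z) - Re (\<Sum>i\<le>n. of_real (a i) * P i z)\<bar> < \<epsilon>"
      by (simp add: a P z Re_sum)
  qed
qed

lemma holomorphic_circle_mean:
  fixes f :: "complex \<Rightarrow> complex"
  assumes "continuous_on (cball 0 1) f" "f holomorphic_on ball 0 1"
  shows "((\<lambda>t. f (cis t)) has_integral (2 * pi * f 0)) {0..2 * pi}"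
proof -
  have "((\<lambda>u. f u / (u - 0)) has_contour_integral (2 * of_real pi * \<i> * f 0)) (circlepath 0 1)"
    by (rule Cauchy_integral_circlepath) (use assms in auto)
  then have "((\<lambda>t. f (cis t) * \<i>) has_integral (2 * of_real pi * \<i> * f 0)) {0..2 * pi}"
    unfolding circlepath_def by (simp add: has_contour_integral_part_circlepath_iff mult_ac)
  from has_integral_mult_left[OF this, of "- \<i>"]
  show ?thesis by (simp add: mult_ac)
qed

text \<open>
  For fixed \<open>c\<close>, the function \<open>U c * \<bar>K w\<bar> - Re (Q w)\<close> is subharmonic in \<open>w\<close>, where \<open>Re Q\<close>
  approximates \<open>\<beta> (Re w)\<close> on the circle. Hence the bound by \<open>\<alpha> c\<close>, up to the approximation error,
  passes from the circle to the disc, and \<open>w = \<omega> z\<close> may be inserted. Integration removes \<open>\<omega>\<close>, since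
  \<open>Q \<circ> \<omega>\<close> and \<open>Q\<close> have the same circle mean \<open>Q 0\<close>. What remains is the integral of
  \<open>\<alpha> + \<beta> = U * V\<close>.
\<close>
lemma integral_subordinate_le:
  fixes U V \<alpha> \<beta> :: "real \<Rightarrow> real" and K \<omega> :: "complex \<Rightarrow> complex"
  assumes contU: "continuous_on {-1..1} U"
    and cont\<alpha>: "continuous_on {-1..1} \<alpha>" and cont\<beta>: "continuous_on {-1..1} \<beta>"
    and U0: "\<And>c. c \<in> {-1..1} \<Longrightarrow> 0 \<le> U c"
    and le: "\<And>c d. c \<in> {-1..1} \<Longrightarrow> d \<in> {-1..1} \<Longrightarrow> U c * V d \<le> \<alpha> c + \<beta> d"
    and eq: "\<And>c. U c * V c = \<alpha> c + \<beta> c"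
    and contK: "continuous_on (cball 0 1) K" and holK: "K holomorphic_on ball 0 1"
    and KV: "\<And>z. cmod z = 1 \<Longrightarrow> cmod (K z) = V (Re z)"
    and cont\<omega>: "continuous_on (cball 0 1) \<omega>" and hol\<omega>: "\<omega> holomorphic_on ball 0 1"
    and \<omega>1: "\<And>z. cmod z \<le> 1 \<Longrightarrow> cmod (\<omega> z) \<le> 1" and \<omega>0: "\<omega> 0 = 0"
  shows "integral {0..2 * pi} (\<lambda>t. U (cos t) * cmod (K (\<omega> (cis t))))
       \<le> integral {0..2 * pi} (\<lambda>t. U (cos t) * V (cos t))" (is "?L \<le> ?R")
proof (rule field_le_epsilon)
  fix e :: real assume "0 < e"
  define \<epsilon> where "\<epsilon> = e / (4 * pi)"
  have \<epsilon>: "0 < \<epsilon>" using \<open>0 < e\<close> by (simp add: \<epsilon>_def)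
  obtain Q where Q: "Q holomorphic_on UNIV"
    and Q\<beta>: "\<And>z. cmod z = 1 \<Longrightarrow> \<bar>\<beta> (Re z) - Re (Q z)\<bar> < \<epsilon>"
    using approx_by_harmonic_on_circle[OF cont\<beta> \<epsilon>] by blast
  have contQ: "continuous_on S Q" for S
    using Q holomorphic_on_imp_continuous_on continuous_on_subset by blast
  have pt: "U c * cmod (K w) \<le> \<alpha> c + \<epsilon> + Re (Q w)" if c: "c \<in> {-1..1}" and w: "cmod w \<le> 1" for c w
  proof -
    \<comment> \<open>A rotation by \<open>\<tau>\<close> replaces the subharmonic \<open>\<bar>K\<bar>\<close> by the harmonic \<open>Re (\<tau> * K)\<close>, which lies below it
      and agrees with it at the given point.\<close>
    define \<tau> where "\<tau> = (if K w = 0 then 1 else cnj (K w) / cmod (K w))"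
    have \<tau>1: "cmod \<tau> = 1" by (simp add: \<tau>_def norm_divide)
    have "K w * cnj (K w) = cmod (K w) * cmod (K w)"
      by (metis complex_norm_square of_real_power power2_eq_square of_real_mult)
    then have \<tau>: "\<tau> * K w = cmod (K w)" by (auto simp: \<tau>_def field_simps)
    define h where "h = (\<lambda>z. of_real (U c) * \<tau> * K z - Q z)"
    have "Re (h w) \<le> \<alpha> c + \<epsilon>"
    proof (rule maximum_real_frontier[where S = "cball 0 1" and f = h and \<xi> = w])
      show "h holomorphic_on interior (cball 0 1)" unfolding h_def
        by (auto intro!: holomorphic_intros holK holomorphic_on_subset[OF Q])
      show "continuous_on (closure (cball 0 1)) h" unfolding h_def
        by (auto intro!: continuous_intros contK contQ)
      fix z :: complex assume "z \<in> frontier (cball 0 1)"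
      then have z: "cmod z = 1" by (simp add: frontier_cball)
      then have "Re z \<in> {-1..1}" using abs_Re_le_cmod[of z] by auto
      have "Re (of_real (U c) * \<tau> * K z) \<le> cmod (of_real (U c) * \<tau> * K z)" by (rule complex_Re_le_cmod)
      also have "\<dots> = U c * V (Re z)" using U0[OF c] by (simp add: norm_mult \<tau>1 KV z)
      also have "\<dots> \<le> \<alpha> c + \<beta> (Re z)" by (rule le) fact+
      finally show "Re (h z) \<le> \<alpha> c + \<epsilon>" using Q\<beta>[OF z] by (simp add: h_def)
    qed (use w in auto)
    moreover have "Re (of_real (U c) * \<tau> * K w) = U c * cmod (K w)"
      by (simp add: mult.assoc \<tau>)
    ultimately show ?thesis by (simp add: h_def)
  qed
  have cont\<omega>': "continuous_on {0..2 * pi} (\<lambda>t. \<omega> (cis t))"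
    by (rule continuous_on_compose2[OF cont\<omega>]) (auto intro!: continuous_intros)
  have int1: "(\<lambda>t. U (cos t) * cmod (K (\<omega> (cis t)))) integrable_on {0..2 * pi}"
    by (intro integrable_continuous_real continuous_intros continuous_on_compose2[OF contU]
        continuous_on_compose2[OF contK] cont\<omega>') (auto intro!: \<omega>1)
  have int\<alpha>: "(\<lambda>t. \<alpha> (cos t)) integrable_on {0..2 * pi}"
    by (intro integrable_continuous_real continuous_intros continuous_on_compose2[OF cont\<alpha>]) auto
  have int\<beta>: "(\<lambda>t. \<beta> (cos t)) integrable_on {0..2 * pi}"
    by (intro integrable_continuous_real continuous_intros continuous_on_compose2[OF cont\<beta>]) auto
  have "((\<lambda>t. (Q \<circ> \<omega>) (cis t)) has_integral (2 * pi * (Q \<circ> \<omega>) 0)) {0..2 * pi}"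
  proof (rule holomorphic_circle_mean)
    show "continuous_on (cball 0 1) (Q \<circ> \<omega>)" by (intro continuous_on_compose cont\<omega> contQ)
    show "Q \<circ> \<omega> holomorphic_on ball 0 1"
      by (rule holomorphic_on_compose[OF hol\<omega> holomorphic_on_subset[OF Q]]) auto
  qed
  from has_integral_Re[OF this]
  have Q\<omega>: "((\<lambda>t. Re (Q (\<omega> (cis t)))) has_integral (2 * pi * Re (Q 0))) {0..2 * pi}"
    by (simp add: \<omega>0)
  have Qc: "((\<lambda>t. Re (Q (cis t))) has_integral (2 * pi * Re (Q 0))) {0..2 * pi}"
    using has_integral_Re[OF holomorphic_circle_mean[OF contQ holomorphic_on_subset[OF Q]]] by simp
  have const: "((\<lambda>t. \<epsilon>) has_integral (2 * pi * \<epsilon>)) {0..2 * pi}"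
    using has_integral_const_real[of \<epsilon> 0 "2 * pi"] by simp
  have Q\<beta>': "Re (Q (cis t)) \<le> \<beta> (cos t) + \<epsilon>" for t
    using Q\<beta>[of "cis t"] by (simp add: abs_less_iff)
  have "?L \<le> integral {0..2 * pi} (\<lambda>t. \<alpha> (cos t)) + 2 * pi * \<epsilon> + 2 * pi * Re (Q 0)"
    by (rule has_integral_le[OF integrable_integral[OF int1]
        has_integral_add[OF has_integral_add[OF integrable_integral[OF int\<alpha>] const] Q\<omega>]])
       (auto intro!: pt \<omega>1)
  moreover have "2 * pi * Re (Q 0) \<le> integral {0..2 * pi} (\<lambda>t. \<beta> (cos t)) + 2 * pi * \<epsilon>"
    by (rule has_integral_le[OF Qc has_integral_add[OF integrable_integral[OF int\<beta>] const]])
       (rule Q\<beta>')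
  moreover have "?R = integral {0..2 * pi} (\<lambda>t. \<alpha> (cos t)) + integral {0..2 * pi} (\<lambda>t. \<beta> (cos t))"
    unfolding eq by (rule integral_add[OF int\<alpha> int\<beta>])
  moreover have "4 * pi * \<epsilon> = e" by (simp add: \<epsilon>_def)
  ultimately show "?L \<le> ?R + e" by linarith
qed

lemma norm_exp_of_real_mult_Ln:
  assumes "z \<noteq> 0"
  shows "cmod (exp (of_real q * Ln z)) = cmod z powr q"
  using assms by (simp add: powr_def)

lemma one_minus_scaled_nonzero:
  fixes z :: complex
  assumes "0 \<le> a" "a < 1" "cmod z \<le> 1"
  shows "1 - of_real a * z \<noteq> 0"
proof
  assume "1 - of_real a * z = 0"
  then have "cmod (of_real a * z) = 1" by simp
  then have "a * cmod z = 1" using assms(1) by (simp add: norm_mult)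
  moreover have "a * cmod z \<le> a * 1" using assms by (intro mult_left_mono) auto
  ultimately show False using assms(2) by linarith
qed

text \<open>
  Whatever the sign of \<open>q\<close>, both factors to the power \<open>q\<close> are, on the unit circle, functions of
  \<open>Re z\<close> that increase together or decrease together, which is the hypothesis of
  \<open>comonotone_product_split\<close>.
\<close>
lemma two_factor_mean_le:
  fixes \<rho> l q :: real and \<omega> :: "complex \<Rightarrow> complex"
  assumes \<rho>: "0 < \<rho>" "\<rho> < 1" and l: "0 < l" "l < 1"
    and cont\<omega>: "continuous_on (cball 0 1) \<omega>" and hol\<omega>: "\<omega> holomorphic_on ball 0 1"
    and \<omega>1: "\<And>z. cmod z \<le> 1 \<Longrightarrow> cmod (\<omega> z) \<le> 1" and \<omega>0: "\<omega> 0 = 0"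
  shows "integral {0..2 * pi} (\<lambda>t. cmod ((1 - of_real \<rho> * cis t) * (1 - of_real l * \<omega> (cis t))) powr q)
       \<le> integral {0..2 * pi} (\<lambda>t. cmod ((1 - of_real \<rho> * cis t) * (1 - of_real l * cis t)) powr q)"
proof -
  \<comment> \<open>\<open>W a (Re z)\<close> is the square of \<open>\<bar>1 - a z\<bar>\<close> on the unit circle, hence the exponents \<open>q / 2\<close> below.\<close>
  define W where "W = (\<lambda>(a::real) (x::real). 1 + a\<^sup>2 - 2 * a * x)"
  have Wpos: "0 < W a x" if "0 < a" "a < 1" "x \<in> {-1..1}" for a x
  proof -
    have "W a x = (1 - a)\<^sup>2 + 2 * a * (1 - x)" by (simp add: W_def power2_eq_square algebra_simps)
    moreover have "0 < (1 - a)\<^sup>2" using that by simp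
    moreover have "0 \<le> 2 * a * (1 - x)" using that by simp
    ultimately show ?thesis by linarith
  qed
  have normW: "cmod (1 - of_real a * z) powr q = W a (Re z) powr (q / 2)"
    if a: "0 < a" "a < 1" and z: "cmod z = 1" for a z
  proof -
    have "(Re z)\<^sup>2 + (Im z)\<^sup>2 = 1" using z by (simp add: cmod_def)
    moreover have "(cmod (1 - of_real a * z))\<^sup>2 = (1 - a * Re z)\<^sup>2 + (a * Im z)\<^sup>2"
      by (simp add: cmod_power2)
    moreover have "(1 - a * Re z)\<^sup>2 + (a * Im z)\<^sup>2 = 1 - 2 * a * Re z + a\<^sup>2 * ((Re z)\<^sup>2 + (Im z)\<^sup>2)"
      by (simp add: power2_eq_square algebra_simps)
    ultimately have sq: "(cmod (1 - of_real a * z))\<^sup>2 = W a (Re z)" by (simp add: W_def)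
    have "Re z \<in> {-1..1}" using z abs_Re_le_cmod[of z] by auto
    from Wpos[OF a this] have "0 < cmod (1 - of_real a * z)"
      using sq by (metis norm_ge_zero order_le_less zero_power2 less_irrefl)
    then have "cmod (1 - of_real a * z) powr q = ((cmod (1 - of_real a * z))\<^sup>2) powr (q / 2)"
      by (simp add: powr_powr flip: powr_numeral)
    then show ?thesis by (simp add: sq)
  qed
  define U where "U = (\<lambda>x. W \<rho> x powr (q / 2))"
  define V where "V = (\<lambda>x. W l x powr (q / 2))"
  define V' where "V' = (\<lambda>x. (q / 2) * W l x powr (q / 2 - 1) * (- 2 * l))"
  have contW: "continuous_on S (W a)" for S a unfolding W_def by (intro continuous_intros)
  have contU: "continuous_on {-1..1} U" unfolding U_def
    by (intro continuous_intros contW) (use Wpos[OF \<rho>] in force)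
  have contV': "continuous_on {-1..1} V'" unfolding V'_def
    by (intro continuous_intros contW) (use Wpos[OF l] in force)
  have derV: "(V has_real_derivative V' x) (at x within {-1..1})" if "x \<in> {-1..1}" for x
  proof -
    have "(W l has_real_derivative - 2 * l) (at x)"
      unfolding W_def by (auto intro!: derivative_eq_intros)
    from DERIV_fun_powr[OF this Wpos[OF l that], of "q / 2"]
    have "(V has_real_derivative V' x) (at x)" by (simp add: V_def V'_def)
    then show ?thesis by (rule has_field_derivative_at_within)
  qed
  have same: "0 \<le> (U x - U y) * V' x * (x - y)" if x: "x \<in> {-1..1}" and y: "y \<in> {-1..1}" for x y
  proof -
    have *: "(U x - U y) * V' x * (x - y) = (l * W l x powr (q / 2 - 1)) * (q * ((U y - U x) * (x - y)))"
      by (simp add: V'_def algebra_simps)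
    have mono: "0 \<le> q * ((U u - U v) * (v - u))" if "u \<le> v" "u \<in> {-1..1}" "v \<in> {-1..1}" for u v
    proof -
      have W: "W \<rho> v \<le> W \<rho> u" using that \<rho> by (simp add: W_def)
      show ?thesis
      proof (cases "0 \<le> q")
        case True
        then have "U v \<le> U u" unfolding U_def using W Wpos[OF \<rho> that(3)] by (intro powr_mono2) auto
        with True that show ?thesis by simp
      next
        case False
        then have "U u \<le> U v" unfolding U_def using W Wpos[OF \<rho> that(3)] by (intro powr_mono2') auto
        with False that show ?thesis
          by (intro mult_nonpos_nonpos mult_nonpos_nonneg) auto
      qed
    qed
    have "0 \<le> q * ((U y - U x) * (x - y))"
    proof (cases "x \<le> y")
      case True
      have "(U y - U x) * (x - y) = (U x - U y) * (y - x)" by (simp add: algebra_simps)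
      with mono[OF True x y] show ?thesis by simp
    next
      case False
      then show ?thesis using mono[of y x] x y by simp
    qed
    then show ?thesis unfolding * using l by simp
  qed
  obtain \<alpha> \<beta> where ab: "continuous_on {-1..1} \<alpha>" "continuous_on {-1..1} \<beta>"
    "\<And>c d. c \<in> {-1..1} \<Longrightarrow> d \<in> {-1..1} \<Longrightarrow> U c * V d \<le> \<alpha> c + \<beta> d"
    "\<And>c. U c * V c = \<alpha> c + \<beta> c"
    using comonotone_product_split[OF contU contV' derV same] by blast
  have pos: "0 < Re (1 - of_real l * z)" if "cmod z \<le> 1" for z
  proof -
    have "l * Re z \<le> l * 1" using abs_Re_le_cmod[of z] that l by (intro mult_left_mono) auto
    then have "l * Re z < 1" using l by linarith
    then show ?thesis by simp
  qed
  define K where "K = (\<lambda>z. exp (of_real q * Ln (1 - of_real l * z)))"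
  have slit: "1 - of_real l * z \<notin> \<real>\<^sub>\<le>\<^sub>0" if "cmod z \<le> 1" for z
    using pos[OF that] by (auto simp: complex_nonpos_Reals_iff)
  have normK: "cmod (K z) = cmod (1 - of_real l * z) powr q" if "cmod z \<le> 1" for z
    unfolding K_def
    by (rule norm_exp_of_real_mult_Ln) (metis pos[OF that] less_irrefl zero_complex.sel(1))
  have contK: "continuous_on (cball 0 1) K"
    unfolding K_def by (intro continuous_intros) (use slit in auto)
  have holK: "K holomorphic_on ball 0 1"
    unfolding K_def by (intro holomorphic_intros) (use slit in auto)
  have "integral {0..2 * pi} (\<lambda>t. U (cos t) * cmod (K (\<omega> (cis t))))
      \<le> integral {0..2 * pi} (\<lambda>t. U (cos t) * V (cos t))"
    by (rule integral_subordinate_le[OF contU ab(1,2) _ ab(3,4) contK holK _ cont\<omega> hol\<omega> \<omega>1 \<omega>0])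
       (use normK normW[OF l] in \<open>auto simp: U_def V_def\<close>)
  moreover have "U (cos t) = cmod (1 - of_real \<rho> * cis t) powr q" for t
    using normW[OF \<rho>, of "cis t"] by (simp add: U_def)
  moreover have "V (cos t) = cmod (1 - of_real l * cis t) powr q" for t
    using normW[OF l, of "cis t"] by (simp add: V_def)
  moreover have "cmod (K (\<omega> (cis t))) = cmod (1 - of_real l * \<omega> (cis t)) powr q" for t
    by (intro normK \<omega>1) simp
  ultimately show ?thesis by (simp add: norm_mult powr_mult)
qed

section \<open>A maximum principle in the parameter\<close>

text \<open>
  The set \<open>A\<close> of parameters where the integral is maximal is compact. Near an interior point \<open>b1\<close> of
  \<open>E\<close> that belongs to \<open>A\<close>, the integral dominates the modulus of a holomorphic function of the
  parameter, with equality at \<open>b1\<close>. By the maximum modulus principle that function is constant, so a whole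
  neighbourhood of \<open>b1\<close> lies in \<open>A\<close>. A nonempty compact set is not open, hence \<open>A\<close> meets the
  frontier of \<open>E\<close>.
\<close>
lemma integral_norm_powr_affine_le_frontier:
  fixes h k :: "real \<Rightarrow> complex" and E :: "complex set" and q M :: real
  assumes E: "compact E" and conth: "continuous_on {a..c} h" and contk: "continuous_on {a..c} k"
    and nz: "\<And>b t. b \<in> E \<Longrightarrow> t \<in> {a..c} \<Longrightarrow> h t + b * k t \<noteq> 0"
    and frontier: "\<And>b. b \<in> frontier E \<Longrightarrow> integral {a..c} (\<lambda>t. cmod (h t + b * k t) powr q) \<le> M"
    and b: "b \<in> E"
  shows "integral {a..c} (\<lambda>t. cmod (h t + b * k t) powr q) \<le> M"
proof -
  define J where "J = (\<lambda>b. integral {a..c} (\<lambda>t. cmod (h t + b * k t) powr q))"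
  note cint = continuous_on_compose2[OF conth] continuous_on_compose2[OF contk]
  have contJ: "continuous_on E J"
    unfolding J_def cbox_interval[symmetric]
    by (rule integral_continuous_on_param, unfold split_beta)
       (use nz in \<open>auto intro!: continuous_intros cint simp: split_beta\<close>)
  obtain b0 where b0: "b0 \<in> E" and max: "\<And>b. b \<in> E \<Longrightarrow> J b \<le> J b0"
    using continuous_attains_sup[OF E _ contJ] b by blast
  define A where "A = {b \<in> E. J b = J b0}"
  have "closed A"
    unfolding A_def
    by (rule continuous_closed_preimage_constant[OF contJ compact_imp_closed[OF E]])
  then have "compact A"
    using E A_def by (metis (no_types, lifting) closed_Int_compact inf.absorb1 mem_Collect_eq subsetI)
  have "A \<inter> frontier E \<noteq> {}"
  proof
    assume disj: "A \<inter> frontier E = {}"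
    have "open A"
      unfolding open_contains_ball
    proof
      fix b1 assume b1: "b1 \<in> A"
      then have "b1 \<in> interior E"
        using disj by (auto simp: A_def frontier_def closure_def)
      then obtain e where e: "0 < e" "ball b1 e \<subseteq> E"
        by (meson mem_interior)
      have b1E: "b1 \<in> E" and Jb1: "J b1 = J b0" using b1 by (auto simp: A_def)
      define g where "g = (\<lambda>t. h t + b1 * k t)"
      define \<kappa> where "\<kappa> = (\<lambda>t. k t / g t)"
      have g0: "g t \<noteq> 0" if "t \<in> {a..c}" for t using nz[OF b1E that] by (simp add: g_def)
      have contg: "continuous_on {a..c} g" unfolding g_def by (intro continuous_intros conth contk)
      have cont\<kappa>: "continuous_on {a..c} \<kappa>" unfolding \<kappa>_def
        using g0 by (intro continuous_intros contk contg) auto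
      have shift: "b1 + s \<in> E" if "s \<in> ball 0 e" for s
        using that e(2) by (auto simp: dist_norm subset_iff)
      have fac: "h t + (b1 + s) * k t = g t * (1 + s * \<kappa> t)" if "t \<in> {a..c}" for s t
        using g0[OF that] by (simp add: \<kappa>_def g_def field_simps)
      have nz1: "1 + s * \<kappa> t \<noteq> 0" if "s \<in> ball 0 e" "t \<in> {a..c}" for s t
        using nz[OF shift[OF that(1)] that(2)] fac[OF that(2)] by auto
      \<comment> \<open>Otherwise the zero \<open>- 1 / \<kappa> t\<close> of \<open>s \<mapsto> 1 + s * \<kappa> t\<close> would lie in the ball, where there is none.\<close>
      have small: "cmod (s * \<kappa> t) < 1" if s: "s \<in> ball 0 e" and t: "t \<in> {a..c}" for s t
      proof (rule ccontr)
        assume "\<not> ?thesis"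
        then have ge: "1 \<le> cmod s * cmod (\<kappa> t)" by (simp add: norm_mult)
        then have \<kappa>0: "\<kappa> t \<noteq> 0" by auto
        then have "cmod (- 1 / \<kappa> t) \<le> cmod s" using ge by (simp add: norm_divide field_simps)
        then have "- 1 / \<kappa> t \<in> ball 0 e" using s by auto
        from nz1[OF this t] \<kappa>0 show False by simp
      qed
      have slit: "1 + s * \<kappa> t \<notin> \<real>\<^sub>\<le>\<^sub>0" if "s \<in> ball 0 e" "t \<in> {a..c}" for s t
      proof -
        have "\<bar>Re (s * \<kappa> t)\<bar> < 1"
          using small[OF that] abs_Re_le_cmod order_le_less_trans by blast
        then show ?thesis by (auto simp: complex_nonpos_Reals_iff)
      qed
      \<comment> \<open>The holomorphic minorant: \<open>q\<close>-th powers of the ratios to \<open>g\<close>, weighted so that they add up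
        without cancellation at \<open>s = 0\<close>.\<close>
      define C where "C = (\<lambda>s. integral (cbox a c)
        (\<lambda>t. of_real (cmod (g t) powr q) * exp (of_real q * Ln (1 + s * \<kappa> t))))"
      define C' where "C' = (\<lambda>s t. of_real (cmod (g t) powr q)
        * (exp (of_real q * Ln (1 + s * \<kappa> t)) * (of_real q * (\<kappa> t / (1 + s * \<kappa> t)))))"
      have contint: "continuous_on {a..c} (\<lambda>t. of_real (cmod (g t) powr q) * exp (of_real q * Ln (1 + s * \<kappa> t)))"
        if "s \<in> ball 0 e" for s
        by (intro continuous_intros contg cont\<kappa>) (use g0 slit[OF that] in auto)
      have "C holomorphic_on ball 0 e"
        unfolding C_def
      proof (rule leibniz_rule_holomorphic[where fx = C'])
        fix s :: complex and t :: real assume s: "s \<in> ball 0 e" and t: "t \<in> cbox a c"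
        then show "((\<lambda>s. of_real (cmod (g t) powr q) * exp (of_real q * Ln (1 + s * \<kappa> t)))
            has_field_derivative C' s t) (at s within ball 0 e)"
          unfolding C'_def using slit[of s t]
          by (auto intro!: derivative_eq_intros simp: field_simps)
      next
        show "continuous_on (ball 0 e \<times> cbox a c) (\<lambda>(s, t). C' s t)"
          unfolding C'_def split_beta
          by (intro continuous_intros continuous_on_compose2[OF contg] continuous_on_compose2[OF cont\<kappa>])
             (use g0 slit nz1 in auto)
      next
        fix s :: complex assume "s \<in> ball 0 e"
        from contint[OF this]
        show "(\<lambda>t. of_real (cmod (g t) powr q) * exp (of_real q * Ln (1 + s * \<kappa> t))) integrable_on cbox a c"
          by (intro integrable_continuous) simp
      qed auto
      have "((\<lambda>t. of_real (cmod (g t) powr q) :: complex) has_integral of_real (J b1)) {a..c}"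
        unfolding J_def g_def
        by (intro has_integral_of_real integrable_integral integrable_continuous_real
            continuous_intros conth contk) (use nz[OF b1E] in auto)
      then have C0: "C 0 = of_real (J b0)"
        unfolding C_def by (simp add: integral_unique Jb1)
      have CJ: "cmod (C s) \<le> J (b1 + s)" if s: "s \<in> ball 0 e" for s
        unfolding C_def J_def cbox_interval
      proof (rule integral_norm_bound_integral)
        show "(\<lambda>t. of_real (cmod (g t) powr q) * exp (of_real q * Ln (1 + s * \<kappa> t))) integrable_on {a..c}"
          by (intro integrable_continuous_real contint s)
        show "(\<lambda>t. cmod (h t + (b1 + s) * k t) powr q) integrable_on {a..c}"
          by (intro integrable_continuous_real continuous_intros conth contk)
             (use nz[OF shift[OF s]] in auto)
        fix t assume t: "t \<in> {a..c}"
        show "cmod (of_real (cmod (g t) powr q) * exp (of_real q * Ln (1 + s * \<kappa> t)))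
            \<le> cmod (h t + (b1 + s) * k t) powr q"
          unfolding fac[OF t]
          by (simp add: norm_mult norm_exp_of_real_mult_Ln[OF nz1[OF s t]] powr_mult
              del: norm_exp_eq_Re)
      qed
      have J0: "0 \<le> J b0" unfolding J_def by (intro integral_nonneg integrable_continuous_real
          continuous_intros conth contk) (use nz[OF b0] in auto)
      have "C constant_on ball 0 e"
      proof (rule maximum_modulus_principle[where U = "ball 0 e" and \<xi> = 0])
        fix s :: complex assume s: "s \<in> ball 0 e"
        have "cmod (C s) \<le> J b0" using CJ[OF s] max[OF shift[OF s]] by linarith
        then show "cmod (C s) \<le> cmod (C 0)" using J0 by (simp add: C0)
      qed (use e \<open>C holomorphic_on ball 0 e\<close> in auto)
      then have const: "C s = C 0" if "s \<in> ball 0 e" for s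
        using that e(1) unfolding constant_on_def by (metis centre_in_ball)
      have "b1 + s \<in> A" if s: "s \<in> ball 0 e" for s
        using CJ[OF s] const[OF s] C0 J0 max[OF shift[OF s]] shift[OF s] by (simp add: A_def)
      then have "x \<in> A" if "x \<in> ball b1 e" for x
        using that[unfolded mem_ball dist_norm]
        by (metis add.commute diff_add_cancel mem_ball_0 norm_minus_commute)
      then show "\<exists>e>0. ball b1 e \<subseteq> A" using e(1) by blast
    qed
    with \<open>compact A\<close> have "A = {}" using compact_open by blast
    with b0 show False by (auto simp: A_def)
  qed
  then obtain b1 where "b1 \<in> frontier E" "J b1 = J b0" by (auto simp: A_def)
  with frontier[of b1] max[OF b] show ?thesis by (simp add: J_def)
qed

section \<open>Zero-free members of an affine family\<close>

definition zero_free_parameters :: "(complex \<Rightarrow> complex) \<Rightarrow> real \<Rightarrow> complex set" where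
  "zero_free_parameters m s = {b. \<forall>z\<in>ball 0 s. 1 + z * (m z + b) \<noteq> 0}"

text \<open>
  For large \<open>b\<close> the map \<open>z \<mapsto> - 1 / (m z + b)\<close> sends a small closed disc into itself, and its
  Brouwer fixed point is a zero of \<open>1 + z * (m z + b)\<close>.
\<close>
lemma bounded_zero_free_parameters:
  assumes contm: "continuous_on (ball 0 1) m" and s: "0 < s" "s \<le> 1"
  shows "bounded (zero_free_parameters m s)"
proof -
  have sub: "cball 0 (s / 2) \<subseteq> ball (0::complex) 1" using s by auto
  have "compact (m ` cball 0 (s / 2))"
    by (intro compact_continuous_image continuous_on_subset[OF contm sub]) auto
  then obtain B where B: "\<And>z. z \<in> cball 0 (s / 2) \<Longrightarrow> cmod (m z) \<le> B"
    using compact_imp_bounded bounded_iff by (metis image_eqI)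
  have "cmod b \<le> B + 2 / s" if b: "b \<in> zero_free_parameters m s" for b
  proof (rule ccontr)
    assume "\<not> ?thesis"
    then have big: "B + 2 / s < cmod b" by simp
    have low: "2 / s < cmod (m z + b)" if "z \<in> cball 0 (s / 2)" for z
      using norm_diff_ineq[of b "m z"] B[OF that] big by (simp add: add.commute)
    have s2: "0 < 2 / s" using s by simp
    have "continuous_on (cball 0 (s / 2)) (\<lambda>z. - 1 / (m z + b))"
      by (intro continuous_intros continuous_on_subset[OF contm sub])
         (use low s2 in \<open>metis norm_zero less_trans less_irrefl\<close>)
    moreover have "(\<lambda>z. - 1 / (m z + b)) \<in> cball 0 (s / 2) \<rightarrow> cball 0 (s / 2)"
    proof
      fix z :: complex assume "z \<in> cball 0 (s / 2)"
      from low[OF this] have "1 / cmod (m z + b) \<le> 1 / (2 / s)"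
        using s2 by (intro frac_le) linarith+
      then show "- 1 / (m z + b) \<in> cball 0 (s / 2)" by (simp add: norm_divide)
    qed
    ultimately obtain z where z: "z \<in> cball 0 (s / 2)" "- 1 / (m z + b) = z"
      using brouwer[of "cball 0 (s / 2)" "\<lambda>z. - 1 / (m z + b)"] s by auto
    have "m z + b \<noteq> 0" using low[OF z(1)] s2 by auto
    then have "z * (m z + b) = - 1" using z(2) by (metis nonzero_eq_divide_eq)
    then have "1 + z * (m z + b) = 0" by simp
    moreover have "z \<in> ball 0 s" using z(1) s by auto
    ultimately show False using b by (auto simp: zero_free_parameters_def)
  qed
  then show ?thesis by (auto simp: bounded_iff)
qed

text \<open>
  The complement is the image of the punctured disc under \<open>N z = - 1 / z - m z\<close>. The Lipschitz bound
  makes \<open>N\<close> injective, since \<open>1 / z\<close> expands distances strictly inside the unit disc. So the image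
  is open.
\<close>
lemma closed_zero_free_parameters:
  assumes holm: "m holomorphic_on ball 0 1" and s: "0 < s" "s \<le> 1"
    and lip: "\<And>z w. z \<in> ball 0 1 \<Longrightarrow> w \<in> ball 0 1 \<Longrightarrow> cmod (m z - m w) \<le> cmod (z - w)"
  shows "closed (zero_free_parameters m s)"
proof -
  define N where "N = (\<lambda>z. - 1 / z - m z)"
  have sub: "ball 0 s - {0} \<subseteq> ball (0::complex) 1" using s by auto
  have "inj_on N (ball 0 s - {0})"
  proof
    fix z w assume z: "z \<in> ball 0 s - {0}" and w: "w \<in> ball 0 s - {0}" and "N z = N w"
    then have "(z - w) / (z * w) = m z - m w"
      by (auto simp: N_def field_simps)
    then have "cmod (z - w) / (cmod z * cmod w) = cmod (m z - m w)"
      by (metis norm_divide norm_mult)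
    also have "\<dots> \<le> cmod (z - w)" using lip z w sub by blast
    finally have le: "cmod (z - w) / (cmod z * cmod w) \<le> cmod (z - w)" .
    have zw: "0 < cmod z * cmod w" "cmod z * cmod w < 1"
      using z w s mult_strict_mono[of "cmod z" 1 "cmod w" 1] by auto
    show "z = w"
    proof (rule ccontr)
      assume "z \<noteq> w"
      then have "cmod (z - w) < cmod (z - w) / (cmod z * cmod w)"
        using zw by (simp add: less_divide_eq)
      with le show False by simp
    qed
  qed
  moreover have "N holomorphic_on ball 0 s - {0}"
    unfolding N_def by (intro holomorphic_intros holomorphic_on_subset[OF holm sub]) auto
  ultimately have "open (N ` (ball 0 s - {0}))"
    by (intro open_mapping_thm3) auto
  moreover have "N ` (ball 0 s - {0}) = - zero_free_parameters m s"
  proof -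
    have "b = N z \<longleftrightarrow> 1 + z * (m z + b) = 0" if "z \<noteq> 0" for b z
    proof -
      have "b = N z \<longleftrightarrow> z * b = z * N z" using that by simp
      also have "z * N z = - 1 - z * m z" using that by (simp add: N_def field_simps)
      also have "z * b = - 1 - z * m z \<longleftrightarrow> 1 + z * (m z + b) = 0"
        by (auto simp: algebra_simps add_eq_0_iff)
      finally show ?thesis .
    qed
    then show ?thesis by (fastforce simp: zero_free_parameters_def image_iff)
  qed
  ultimately show ?thesis by (simp add: closed_def)
qed

text \<open>
  A frontier parameter is a limit of parameters that have a zero in the open disc. By compactness a zero
  survives in the closed disc, and it cannot lie inside.
\<close>
lemma frontier_zero_free_parameters:
  assumes contm: "continuous_on (ball 0 1) m" and s: "0 < s" "s < 1"
    and clo: "closed (zero_free_parameters m s)"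
    and b: "b \<in> frontier (zero_free_parameters m s)"
  obtains x where "cmod x = s" "1 + x * (m x + b) = 0"
proof -
  define T where "T = {y \<in> cball 0 s \<times> (UNIV::complex set). 1 + fst y * (m (fst y) + snd y) = 0}"
  have sub: "cball 0 s \<subseteq> ball (0::complex) 1" using s by auto
  have "closed T" unfolding T_def
  proof (rule continuous_closed_preimage_constant)
    show "continuous_on (cball 0 s \<times> UNIV) (\<lambda>y. 1 + fst y * (m (fst y) + snd y))"
      by (intro continuous_intros continuous_on_compose2[OF contm]) (use sub in auto)
  qed (intro closed_Times closed_cball closed_UNIV)
  then have "closed {b. \<exists>z. z \<in> cball 0 s \<and> (z, b) \<in> T}"
    by (intro closed_compact_projection compact_cball)
  moreover have "- zero_free_parameters m s \<subseteq> {b. \<exists>z. z \<in> cball 0 s \<and> (z, b) \<in> T}"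
    by (force simp: zero_free_parameters_def T_def)
  ultimately have "closure (- zero_free_parameters m s) \<subseteq> {b. \<exists>z. z \<in> cball 0 s \<and> (z, b) \<in> T}"
    by (rule closure_minimal[rotated])
  moreover have "b \<in> closure (- zero_free_parameters m s)" "b \<in> zero_free_parameters m s"
    using b clo by (auto simp: frontier_closures)
  ultimately obtain x where x: "cmod x \<le> s" "1 + x * (m x + b) = 0"
    by (auto simp: T_def)
  with \<open>b \<in> zero_free_parameters m s\<close> have "\<not> cmod x < s"
    by (auto simp: zero_free_parameters_def)
  with x that show thesis by force
qed

section \<open>Integral means on the frontier of the parameter set\<close>

lemma integral_circle_rotate:
  fixes F :: "complex \<Rightarrow> real"
  assumes contF: "continuous_on (sphere 0 1) F" and c: "cmod c = 1"
  shows "integral {0..2 * pi} (\<lambda>t. F (c * cis t)) = integral {0..2 * pi} (\<lambda>t. F (cis t))"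
proof -
  define \<tau> where "\<tau> = Arg2pi c"
  have \<tau>: "0 \<le> \<tau>" "\<tau> < 2 * pi" by (simp_all add: \<tau>_def Arg2pi_ge_0 Arg2pi_lt_2pi)
  have c': "c = cis \<tau>"
    using Arg2pi_eq[of c] c by (simp add: \<tau>_def cis_conv_exp)
  define G where "G = (\<lambda>t. F (cis t))"
  have int: "G integrable_on {u..v}" for u v
    unfolding G_def by (intro integrable_continuous_real continuous_on_compose2[OF contF] continuous_intros) auto
  have per: "G (t + 2 * pi) = G t" for t by (simp add: G_def flip: cis_mult)
  have "integral {0..2 * pi} (\<lambda>t. F (c * cis t)) = integral {0..2 * pi} (\<lambda>t. G (t + \<tau>))"
    by (simp add: G_def c' cis_mult add.commute)
  also have "\<dots> = integral {\<tau>..2 * pi + \<tau>} G"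
    using integral_shift_Icc_real[of 0 "2 * pi" G \<tau>] by (simp add: o_def add.commute)
  also have "\<dots> = integral {\<tau>..2 * pi} G + integral {2 * pi..2 * pi + \<tau>} G"
    by (rule Henstock_Kurzweil_Integration.integral_combine[symmetric]) (use \<tau> int in auto)
  also have "integral {2 * pi..2 * pi + \<tau>} G = integral {0..\<tau>} (\<lambda>t. G (t + 2 * pi))"
    using integral_shift_Icc_real[of 0 \<tau> G "2 * pi"] by (simp add: o_def add.commute)
  also have "\<dots> = integral {0..\<tau>} G" by (simp add: per)
  also have "integral {\<tau>..2 * pi} G + integral {0..\<tau>} G = integral {0..2 * pi} G"
    using Henstock_Kurzweil_Integration.integral_combine[of 0 \<tau> "2 * pi" G] \<tau> int by auto
  finally show ?thesis by (simp add: G_def)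
qed

lemma norm_diff_le_of_norm_deriv_le:
  assumes holm: "m holomorphic_on S" and S: "open S" "convex S"
    and m': "\<And>z. z \<in> S \<Longrightarrow> cmod (deriv m z) \<le> B"
    and zw: "z \<in> S" "w \<in> S"
  shows "cmod (m z - m w) \<le> B * cmod (z - w)"
proof (rule field_differentiable_bound[where S = S and f' = "deriv m"])
  fix v assume "v \<in> S"
  show "(m has_field_derivative deriv m v) (at v within S)"
    using holomorphic_derivI[OF holm S(1) \<open>v \<in> S\<close>] by (rule has_field_derivative_at_within)
qed (use S m' zw in auto)

text \<open>
  Subtracting the equation for the zero \<open>x\<close> gives \<open>1 + z * (m z + b) = (1 - z / x) * (1 - z * x * D z)\<close>,
  where \<open>D\<close> is the difference quotient of \<open>m\<close> at \<open>x\<close> and hence bounded by \<open>lam\<close>. After rotating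
  \<open>x\<close> to the positive axis and rescaling to the unit circle, \<open>two_factor_mean_le\<close> applies.
\<close>
lemma frontier_mean_le:
  fixes lam r s q :: real
  assumes lam: "0 < lam" "lam \<le> 1" and r: "0 < r" "r < s" and s: "s < 1"
    and holm: "m holomorphic_on ball 0 1"
    and m': "\<And>z. z \<in> ball 0 1 \<Longrightarrow> cmod (deriv m z) \<le> lam"
    and x: "cmod x = s" "1 + x * (m x + b) = 0"
  shows "integral {0..2 * pi} (\<lambda>t. cmod (1 + of_real r * cis t * (m (of_real r * cis t) + b)) powr q)
    \<le> integral {0..2 * pi} (\<lambda>t. cmod ((1 - of_real (r / s) * cis t) * (1 - of_real (lam * r) * cis t)) powr q)"
    (is "integral _ (\<lambda>t. cmod (?g (of_real r * cis t)) powr q) \<le> _")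
proof -
  have s0: "0 < s" using r by simp
  have x0: "x \<noteq> 0" using x s0 by auto
  have xb: "x \<in> ball 0 1" using x s by simp
  have sub: "of_real r * z \<in> ball 0 1" if "cmod z \<le> 1" for z :: complex
  proof -
    have "r * cmod z \<le> r * 1" using that r by (intro mult_left_mono) auto
    then have "r * cmod z < 1" using r s by linarith
    then show ?thesis using r by (simp add: norm_mult)
  qed
  define D where "D = (\<lambda>z. if z = x then deriv m x else (m z - m x) / (z - x))"
  have holD: "D holomorphic_on ball 0 1"
    unfolding D_def by (rule pole_lemma_open[OF holm]) simp
  have Dle: "cmod (D z) \<le> lam" if z: "z \<in> ball 0 1" for z
  proof (cases "z = x")
    case True then show ?thesis using m'[OF xb] by (simp add: D_def)
  next
    case False
    have "cmod (m z - m x) \<le> lam * cmod (z - x)"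
      by (rule norm_diff_le_of_norm_deriv_le[OF holm _ _ m' z xb]) auto
    with False show ?thesis by (simp add: D_def norm_divide divide_le_eq)
  qed
  have fac: "?g z = (1 - z / x) * (1 - z * x * D z)" for z
  proof (cases "z = x")
    case True then show ?thesis using x x0 by simp
  next
    case False
    have b: "b = - 1 / x - m x" using x(2) x0 by (simp add: field_simps add_eq_0_iff)
    have "D z * (z - x) = m z - m x" using False by (simp add: D_def)
    then have mz: "m z = m x + D z * (z - x)" by simp
    show ?thesis unfolding mz b using x0 by (simp add: field_simps)
  qed
  define c where "c = x / of_real s"
  have c: "cmod c = 1" using x s0 by (simp add: c_def norm_divide)
  have xc: "x = of_real s * c" using s0 by (simp add: c_def)
  have c0: "c \<noteq> 0" using c by auto
  define \<omega> where "\<omega> = (\<lambda>z. c * z * x * D (of_real r * (c * z)) / of_real lam)"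
  have rc: "of_real r * (c * z) \<in> ball 0 1" if "cmod z \<le> 1" for z
    by (rule sub) (use that c in \<open>simp add: norm_mult\<close>)
  have cont\<omega>: "continuous_on (cball 0 1) \<omega>" unfolding \<omega>_def
    by (intro continuous_intros continuous_on_compose2[OF holomorphic_on_imp_continuous_on[OF holD]])
       (use rc lam in auto)
  have holDc: "(D \<circ> (\<lambda>z. of_real r * (c * z))) holomorphic_on ball 0 1"
    by (rule holomorphic_on_compose_gen[OF _ holD]) (use rc in \<open>auto intro!: holomorphic_intros\<close>)
  have hol\<omega>: "\<omega> holomorphic_on ball 0 1" unfolding \<omega>_def
    by (intro holomorphic_intros holDc[unfolded o_def]) (use lam in auto)
  have \<omega>1: "cmod (\<omega> z) \<le> 1" if z: "cmod z \<le> 1" for z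
  proof -
    have "cmod (c * z * x) \<le> 1"
      using c x s s0 z mult_mono[of "cmod z" 1 s 1] by (simp add: norm_mult)
    then have "cmod (c * z * x) * cmod (D (of_real r * (c * z))) \<le> 1 * lam"
      using Dle[OF rc[OF z]] by (intro mult_mono) auto
    then show ?thesis using lam by (simp add: \<omega>_def norm_divide norm_mult)
  qed
  have "lam * r < 1" using mult_right_mono[of lam 1 r] lam r s by linarith
  then have l: "0 < lam * r" "lam * r < 1" using lam r by auto
  have \<rho>: "0 < r / s" "r / s < 1" using r s0 by auto
  have g\<omega>: "?g (of_real r * (c * z)) = (1 - of_real (r / s) * z) * (1 - of_real (lam * r) * \<omega> z)" for z
  proof -
    have "of_real r * (c * z) / x = of_real (r / s) * z" using c0 s0 by (simp add: xc)
    moreover have "of_real r * (c * z) * x * D (of_real r * (c * z)) = of_real (lam * r) * \<omega> z"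
      using lam by (simp add: \<omega>_def)
    ultimately show ?thesis unfolding fac by metis
  qed
  have gnz: "?g (of_real r * z) \<noteq> 0" if "cmod z = 1" for z
  proof -
    have "cmod (z / c) = 1" using that c by (simp add: norm_divide)
    then have "1 - of_real (r / s) * (z / c) \<noteq> 0" "1 - of_real (lam * r) * \<omega> (z / c) \<noteq> 0"
      using \<rho> l \<omega>1[of "z / c"] by (intro one_minus_scaled_nonzero; linarith)+
    with g\<omega>[of "z / c"] c0 show ?thesis by (simp del: of_real_divide of_real_mult)
  qed
  have "continuous_on (sphere 0 1) (\<lambda>z. cmod (?g (of_real r * z)) powr q)"
    by (intro continuous_intros continuous_on_compose2[OF holomorphic_on_imp_continuous_on[OF holm]])
       (use sub gnz in auto)
  from integral_circle_rotate[OF this c]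
  have "integral {0..2 * pi} (\<lambda>t. cmod (?g (of_real r * cis t)) powr q)
      = integral {0..2 * pi} (\<lambda>t. cmod (?g (of_real r * (c * cis t))) powr q)" ..
  also have "\<dots> = integral {0..2 * pi} (\<lambda>t. cmod ((1 - of_real (r / s) * cis t) * (1 - of_real (lam * r) * \<omega> (cis t))) powr q)"
    by (simp only: g\<omega>)
  also have "\<dots> \<le> integral {0..2 * pi} (\<lambda>t. cmod ((1 - of_real (r / s) * cis t) * (1 - of_real (lam * r) * cis t)) powr q)"
    by (rule two_factor_mean_le[OF \<rho> l cont\<omega> hol\<omega> \<omega>1]) (simp_all add: \<omega>_def)
  finally show ?thesis .
qed

section \<open>The class U\<close>

text \<open>
  Here \<open>1 + z * m z\<close> is \<open>z / f z\<close>, and \<open>f' (z / f)\<^sup>2 - 1 = - z\<^sup>2 m'\<close>. The defining inequality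
  therefore bounds \<open>\<rho>\<^sup>2 \<bar>m'\<bar>\<close> on each circle of radius \<open>\<rho>\<close>; the maximum modulus principle carries the bound
  inside, as in Schwarz's lemma, and \<open>\<rho> \<rightarrow> 1\<close> removes the factor.
\<close>
lemma class_U_reciprocal:
  assumes f: "f \<in> class_U lam"
  obtains m where "m holomorphic_on ball 0 1"
    "\<And>z. z \<in> ball 0 1 \<Longrightarrow> 1 + z * m z \<noteq> 0"
    "\<And>z. z \<in> ball 0 1 \<Longrightarrow> f z = z / (1 + z * m z)"
    "\<And>z. z \<in> ball 0 1 \<Longrightarrow> cmod (deriv m z) \<le> lam"
proof -
  have disc: "unit_disc = ball 0 1" by (auto simp: unit_disc_def)
  obtain a where holf: "f holomorphic_on ball 0 1" and a: "a 0 = 0" "a 1 = 1"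
    and sums: "\<And>z. z \<in> ball 0 1 \<Longrightarrow> (\<lambda>n. a n * z ^ n) sums f z"
    using f by (auto simp: class_U_def class_A_def disc)
  have fnz: "\<And>z. z \<in> ball 0 1 \<Longrightarrow> z \<noteq> 0 \<Longrightarrow> f z \<noteq> 0"
    and U: "\<And>z. z \<in> ball 0 1 \<Longrightarrow> z \<noteq> 0 \<Longrightarrow> cmod (deriv f z * (z / f z)\<^sup>2 - 1) < lam"
    using f by (force simp: class_U_def disc)+
  have f0: "f 0 = 0"
    using sums_unique2[OF sums[of 0] powser_sums_zero[of a]] a by simp
  have "((\<lambda>z. \<Sum>n. a n * z ^ n) has_field_derivative (\<Sum>n. diffs a n * 0 ^ n)) (at 0)"
    by (rule termdiffs_strong'[where K = 1]) (use sums sums_summable in force)+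
  then have "((\<lambda>z. \<Sum>n. a n * z ^ n) has_field_derivative 1) (at 0)"
    using a by (simp add: powser_zero diffs_def)
  then have "(f has_field_derivative 1) (at 0)"
    by (rule has_field_derivative_transform_within_open[of _ _ _ "ball 0 1"])
       (use sums sums_unique in force)+
  then have f'0: "deriv f 0 = 1" by (rule DERIV_imp_deriv)
  define F where "F = (\<lambda>z. if z = 0 then deriv f 0 else (f z - f 0) / (z - 0))"
  have holF: "F holomorphic_on ball 0 1"
    unfolding F_def by (rule pole_lemma_open[OF holf]) simp
  have Fnz: "F z \<noteq> 0" if "z \<in> ball 0 1" for z
    using fnz[OF that] by (simp add: F_def f0 f'0)
  define g where "g = (\<lambda>z. 1 / F z)"
  have holg: "g holomorphic_on ball 0 1"
    unfolding g_def by (intro holomorphic_intros holF Fnz)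
  have g0: "g 0 = 1" by (simp add: g_def F_def f'0)
  have gnz: "g z \<noteq> 0" if "z \<in> ball 0 1" for z using Fnz[OF that] by (simp add: g_def)
  have fg: "f z = z / g z" if "z \<in> ball 0 1" for z by (simp add: g_def F_def f0)
  define m where "m = (\<lambda>z. if z = 0 then deriv g 0 else (g z - g 0) / (z - 0))"
  have holm: "m holomorphic_on ball 0 1"
    unfolding m_def by (rule pole_lemma_open[OF holg]) simp
  have gm: "g z = 1 + z * m z" for z by (simp add: m_def g0)
  have punctured: "cmod (z\<^sup>2 * deriv m z) \<le> lam" if z: "z \<in> ball 0 1" "z \<noteq> 0" for z
  proof -
    have dm: "(m has_field_derivative deriv m z) (at z)"
      using holomorphic_derivI[OF holm open_ball z(1)] .
    have "((\<lambda>z. z / (1 + z * m z)) has_field_derivative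
        ((1 - z\<^sup>2 * deriv m z) / (g z)\<^sup>2)) (at z)"
      using gnz[OF z(1)] unfolding gm
      by (auto intro!: derivative_eq_intros dm simp: power2_eq_square algebra_simps)
    then have "(f has_field_derivative ((1 - z\<^sup>2 * deriv m z) / (g z)\<^sup>2)) (at z)"
      by (rule has_field_derivative_transform_within_open[of _ _ _ "ball 0 1"])
         (use z fg gm in auto)
    then have "deriv f z * (z / f z)\<^sup>2 = 1 - z\<^sup>2 * deriv m z"
      using gnz[OF z(1)] z fg[OF z(1)] by (simp add: DERIV_imp_deriv power_divide)
    with U[OF z] show ?thesis by simp
  qed
  have "cmod (deriv m w) \<le> lam" if w: "w \<in> ball 0 1" for w
  proof -
    have le: "cmod (deriv m w) * \<rho>\<^sup>2 \<le> lam" if \<rho>: "cmod w < \<rho>" "\<rho> < 1" for \<rho>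
    proof -
      have \<rho>0: "0 < \<rho>" using \<rho>(1) norm_ge_zero[of w] by linarith
      have "cmod (deriv m w) \<le> lam / \<rho>\<^sup>2"
      proof (rule maximum_modulus_frontier[where S = "cball 0 \<rho>" and f = "deriv m"])
        have hol: "deriv m holomorphic_on ball 0 1" by (rule holomorphic_deriv[OF holm open_ball])
        show "deriv m holomorphic_on interior (cball 0 \<rho>)"
          by (rule holomorphic_on_subset[OF hol]) (use \<rho> in auto)
        show "continuous_on (closure (cball 0 \<rho>)) (deriv m)"
          by (rule continuous_on_subset[OF holomorphic_on_imp_continuous_on[OF hol]]) (use \<rho> in auto)
        fix z :: complex assume "z \<in> frontier (cball 0 \<rho>)"
        then have z: "cmod z = \<rho>" by (simp add: frontier_cball)
        with punctured[of z] \<rho> \<rho>0 have "\<rho>\<^sup>2 * cmod (deriv m z) \<le> lam"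
          by (auto simp: norm_mult norm_power)
        with \<rho>0 show "cmod (deriv m z) \<le> lam / \<rho>\<^sup>2" by (simp add: field_simps)
      qed (use \<rho> in auto)
      with \<rho>0 show ?thesis by (simp add: field_simps)
    qed
    have "((\<lambda>\<rho>. cmod (deriv m w) * \<rho>\<^sup>2) \<longlongrightarrow> cmod (deriv m w) * 1\<^sup>2) (at_left 1)"
      by (intro tendsto_intros)
    moreover have "eventually (\<lambda>\<rho>. cmod (deriv m w) * \<rho>\<^sup>2 \<le> lam) (at_left 1)"
      using le w by (intro eventually_at_leftI[of "cmod w"]) auto
    ultimately have "cmod (deriv m w) * 1\<^sup>2 \<le> lam"
      by (rule tendsto_upperbound) simp
    then show ?thesis by simp
  qed
  then show thesis
    using that[OF holm] gnz fg unfolding gm by blast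
qed

text \<open>
  The given function is the member \<open>b = 0\<close> of the affine family, so its mean is at most the largest
  mean over frontier parameters. The radius \<open>s < 1\<close> keeps the extremal zeros \<open>x\<close> inside the disc where
  \<open>m\<close> is defined.
\<close>
lemma reciprocal_mean_le_intermediate:
  fixes lam r s q :: real
  assumes lam: "0 < lam" "lam \<le> 1" and r: "0 < r" "r < s" and s: "s < 1"
    and holm: "m holomorphic_on ball 0 1"
    and nz: "\<And>z. z \<in> ball 0 1 \<Longrightarrow> 1 + z * m z \<noteq> 0"
    and m': "\<And>z. z \<in> ball 0 1 \<Longrightarrow> cmod (deriv m z) \<le> lam"
  shows "integral {0..2 * pi} (\<lambda>t. cmod (1 + of_real r * cis t * m (of_real r * cis t)) powr q)
    \<le> integral {0..2 * pi} (\<lambda>t. cmod ((1 - of_real (r / s) * cis t) * (1 - of_real (lam * r) * cis t)) powr q)"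
    (is "?L \<le> ?R")
proof -
  let ?E = "zero_free_parameters m s"
  let ?z = "\<lambda>t. of_real r * cis t"
  have s0: "0 < s" "s \<le> 1" using r s by auto
  have contm: "continuous_on (ball 0 1) m" by (rule holomorphic_on_imp_continuous_on[OF holm])
  have lip: "cmod (m z - m w) \<le> cmod (z - w)" if "z \<in> ball 0 1" "w \<in> ball 0 1" for z w
  proof -
    have "cmod (deriv m v) \<le> 1" if "v \<in> ball 0 1" for v
      using m'[OF that] lam by simp
    then have "cmod (m z - m w) \<le> 1 * cmod (z - w)"
      by (intro norm_diff_le_of_norm_deriv_le[OF holm]) (use that in auto)
    then show ?thesis by simp
  qed
  have clo: "closed ?E" by (rule closed_zero_free_parameters[OF holm s0 lip])
  then have "compact ?E"
    using bounded_zero_free_parameters[OF contm s0] compact_eq_bounded_closed by blast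
  have affine: "1 + ?z t * m (?z t) + b * ?z t = 1 + ?z t * (m (?z t) + b)" for t b
    by (simp add: algebra_simps)
  have zb: "?z t \<in> ball 0 s" for t using r by (simp add: norm_mult)
  have contz: "continuous_on S ?z" for S by (intro continuous_intros)
  have "integral {0..2 * pi} (\<lambda>t. cmod (1 + ?z t * m (?z t) + 0 * ?z t) powr q) \<le> ?R"
  proof (rule integral_norm_powr_affine_le_frontier[OF \<open>compact ?E\<close>])
    show "continuous_on {0..2 * pi} (\<lambda>t. 1 + ?z t * m (?z t))"
      by (intro continuous_intros continuous_on_compose2[OF contm])
         (use r s in \<open>auto simp: norm_mult\<close>)
    show "1 + ?z t * m (?z t) + b * ?z t \<noteq> 0" if "b \<in> ?E" for b t
      unfolding affine using that zb[of t] by (auto simp: zero_free_parameters_def)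
    show "0 \<in> ?E" using nz s0 by (auto simp: zero_free_parameters_def)
    fix b assume "b \<in> frontier ?E"
    then obtain x where "cmod x = s" "1 + x * (m x + b) = 0"
      using frontier_zero_free_parameters[OF contm s0(1) s clo] by blast
    from frontier_mean_le[OF lam r s holm m' this, of q]
    show "integral {0..2 * pi} (\<lambda>t. cmod (1 + ?z t * m (?z t) + b * ?z t) powr q) \<le> ?R"
      by (simp only: affine)
  qed (rule contz)
  then show ?thesis by simp
qed

lemma reciprocal_mean_le:
  fixes lam r q :: real
  assumes lam: "0 < lam" "lam \<le> 1" and r: "0 < r" "r < 1"
    and holm: "m holomorphic_on ball 0 1"
    and nz: "\<And>z. z \<in> ball 0 1 \<Longrightarrow> 1 + z * m z \<noteq> 0"
    and m': "\<And>z. z \<in> ball 0 1 \<Longrightarrow> cmod (deriv m z) \<le> lam"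
  shows "integral {0..2 * pi} (\<lambda>t. cmod (1 + of_real r * cis t * m (of_real r * cis t)) powr q)
    \<le> integral {0..2 * pi} (\<lambda>t. cmod ((1 - of_real r * cis t) * (1 - of_real (lam * r) * cis t)) powr q)"
    (is "?L \<le> _")
proof -
  define R where "R = (\<lambda>s. integral {0..2 * pi}
    (\<lambda>t. cmod ((1 - of_real (r / s) * cis t) * (1 - of_real (lam * r) * cis t)) powr q))"
  \<comment> \<open>Stay away from \<open>s = r\<close>, where \<open>1 - (r / s) * cis t\<close> vanishes at \<open>t = 0\<close>.\<close>
  define s0 where "s0 = (1 + r) / 2"
  have s0: "r < s0" "s0 < 1" using r by (auto simp: s0_def)
  have "lam * r < 1" using mult_right_mono[of lam 1 r] lam r by linarith
  then have lr: "0 < lam * r" "lam * r < 1" using lam r by auto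
  have contR: "continuous_on (cbox s0 1) R"
    unfolding R_def cbox_interval[symmetric]
  proof (rule integral_continuous_on_param, unfold split_beta)
    have "(1 - of_real (r / fst y) * cis (snd y)) * (1 - of_real (lam * r) * cis (snd y)) \<noteq> 0"
      if "y \<in> cbox s0 1 \<times> cbox 0 (2 * pi)" for y :: "real \<times> real"
    proof -
      have "0 \<le> r / fst y" "r / fst y < 1" using that s0 r by auto
      from one_minus_scaled_nonzero[OF this, of "cis (snd y)"]
        one_minus_scaled_nonzero[of "lam * r" "cis (snd y)"] lr
      show ?thesis by (simp del: of_real_divide of_real_mult)
    qed
    moreover have "\<forall>y\<in>cbox s0 1 \<times> cbox 0 (2 * pi). fst y \<noteq> 0" using s0 r by auto
    ultimately show "continuous_on (cbox s0 1 \<times> cbox 0 (2 * pi)) (\<lambda>y.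
        cmod ((1 - of_real (r / fst y) * cis (snd y)) * (1 - of_real (lam * r) * cis (snd y))) powr q)"
      by (intro continuous_intros) auto
  qed
  have "?L \<le> R 1"
  proof (rule continuous_ge_on_closure[where S = "{s0<..<1}" and f = R])
    show "continuous_on (closure {s0<..<1}) R" using contR s0 by simp
    show "1 \<in> closure {s0<..<1}" using s0 by simp
    show "?L \<le> R s" if "s \<in> {s0<..<1}" for s
      unfolding R_def
      by (rule reciprocal_mean_le_intermediate[OF lam r(1) _ _ holm nz m']) (use that s0 in auto)
  qed
  then show ?thesis by (simp add: R_def)
qed

theorem corollary2p3:
  fixes lam r p :: real and f :: "complex \<Rightarrow> complex"
  assumes "0 < lam" and "lam \<le> 1"
    and "f \<in> class_U lam"
    and "0 < r" and "r < 1"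
  shows "1 / (2 * pi) *
           integral {0..2 * pi} (\<lambda>\<theta>. cmod (f (of_real r * exp (\<i> * of_real \<theta>))) powr p)
       \<le> 1 / (2 * pi) *
           integral {0..2 * pi} (\<lambda>\<theta>. cmod (k_fun lam (of_real r * exp (\<i> * of_real \<theta>))) powr p)"
proof -
  obtain m where holm: "m holomorphic_on ball 0 1"
    and nz: "\<And>z. z \<in> ball 0 1 \<Longrightarrow> 1 + z * m z \<noteq> 0"
    and fm: "\<And>z. z \<in> ball 0 1 \<Longrightarrow> f z = z / (1 + z * m z)"
    and m': "\<And>z. z \<in> ball 0 1 \<Longrightarrow> cmod (deriv m z) \<le> lam"
    using class_U_reciprocal[OF assms(3)] by blast
  have quotient: "cmod (of_real r * cis t / w) powr p = r powr p * cmod w powr (- p)" for t w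
    using assms(4) by (simp add: norm_divide norm_mult powr_divide powr_minus_divide)
  have "of_real r * cis t \<in> ball 0 1" for t using assms(4,5) by (simp add: norm_mult)
  then have "cmod (f (of_real r * cis t)) powr p
      = r powr p * cmod (1 + of_real r * cis t * m (of_real r * cis t)) powr (- p)" for t
    by (simp only: fm quotient)
  moreover have "cmod (k_fun lam (of_real r * cis t)) powr p
      = r powr p * cmod ((1 - of_real r * cis t) * (1 - of_real (lam * r) * cis t)) powr (- p)" for t
    unfolding k_fun_def quotient by (simp add: mult.assoc)
  ultimately show ?thesis
    using reciprocal_mean_le[OF assms(1,2,4,5) holm nz m', of "- p"] assms(4)
    by (simp add: divide_right_mono flip: cis_conv_exp)
qed

end
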